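(* Let $d\ge q\ge 2$ be integers and let $\mathbf r=(r_1,\dots,r_d)$ and $\mathbf n=(n_1,\dots,n_d)$ be integer vectors with $1\le r_i\le n_i$ for all $i\in[d]$. Then the directed weak saturation number of $K^q_{\mathbf r}$ in $K^q_{\mathbf n}$ is $$\mathrm{w}(K^q_{\mathbf n},K^q_{\mathbf r})=\sum_{I\in\binom{[d]}{q}}\ \prod_{i\in I}n_i\;-\;\sum_{I\in\binom{[d]}{\le q}}\ \prod_{i\in I}(n_i-r_i),$$ where the empty product equals $1$.
   Context: A $q$-graph is a $q$-uniform hypergraph, identified with its edge set. $[d]=\{1,\dots,d\}$; $\binom{M}{q}$ and $\binom{M}{\le q}$ denote the sets of all subsets of $M$ of size exactly $q$ and at most $q$ (including the empty set), respectively. Let $N=N_1\sqcup\dots\sqcup N_d$ be a disjoint union with $|N_i|=n_i$. $K^q_{\mathbf n}$ is the complete $d$-partite $q$-graph on $N$: its edges are all $q$-subsets $e\subseteq N$ with $|e\cap N_i|\le 1$ for all $i\in[d]$. For $M\subseteq N$, $K^q_{\mathbf n}[M]$ is the induced subgraph on $M$. A (directed) copy of $K^q_{\mathbf r}$ in $K^q_{\mathbf n}$ is a subgraph of the form $K^q_{\mathbf n}[R]$ with $R\subseteq N$ and $|R\cap N_i|=r_i$ for all $i\in[d]$. For $G\subseteq K^q_{\mathbf n}$, a sequence of edges $e_1,\dots,e_k$ of $K^q_{\mathbf n}$ is a (directed) $K^q_{\mathbf r}$-saturating sequence of $G$ in $K^q_{\mathbf n}$ if (i) it is an ordering of the edges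 of $K^q_{\mathbf n}\setminus G$, and (ii) for every $j\in[k]$ there is a directed copy $H_j\subseteq G\cup\{e_1,\dots,e_j\}$ of $K^q_{\mathbf r}$ with $e_j\in H_j$. $G$ is (directed) weakly $K^q_{\mathbf r}$-saturated in $K^q_{\mathbf n}$ if such a sequence exists. $\mathrm{w}(K^q_{\mathbf n},K^q_{\mathbf r})$ is the minimum number of edges of a directed weakly $K^q_{\mathbf r}$-saturated subgraph of $K^q_{\mathbf n}$. *)

theory Defs
  imports "HOL-Library.Disjoint_Sets"
begin

text \<open>A \<open>q\<close>-graph is represented by its edge set. The parts of the vertex set are
  \<open>N 1, \<dots>, N d\<close>; values of \<open>N\<close> (and of \<open>r\<close>, \<open>n\<close>) outside \<open>{1..d}\<close> are irrelevant.\<close>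

definition vertices :: "nat \<Rightarrow> (nat \<Rightarrow> 'a set) \<Rightarrow> 'a set" where
  "vertices d N = (\<Union>i\<in>{1..d}. N i)"

definition complete_partite :: "nat \<Rightarrow> nat \<Rightarrow> (nat \<Rightarrow> 'a set) \<Rightarrow> 'a set set" where
  "complete_partite q d N =
     {e. e \<subseteq> vertices d N \<and> finite e \<and> card e = q \<and> (\<forall>i\<in>{1..d}. card (e \<inter> N i) \<le> 1)}"

definition induced_subgraph :: "'a set set \<Rightarrow> 'a set \<Rightarrow> 'a set set" where
  "induced_subgraph E M = {e \<in> E. e \<subseteq> M}"

definition directed_copy ::
    "nat \<Rightarrow> nat \<Rightarrow> (nat \<Rightarrow> 'a set) \<Rightarrow> (nat \<Rightarrow> nat) \<Rightarrow> 'a set set \<Rightarrow> bool" where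
  "directed_copy q d N r H \<longleftrightarrow>
     (\<exists>R. R \<subseteq> vertices d N \<and> (\<forall>i\<in>{1..d}. card (R \<inter> N i) = r i) \<and>
          H = induced_subgraph (complete_partite q d N) R)"

text \<open>Lists are indexed from 0, so \<open>e\<^sub>1, \<dots>, e\<^sub>j\<close> with \<open>e\<^sub>j = es ! (j - 1)\<close>
  corresponds to \<open>take j es\<close>.\<close>

definition saturating_sequence ::
    "nat \<Rightarrow> nat \<Rightarrow> (nat \<Rightarrow> 'a set) \<Rightarrow> (nat \<Rightarrow> nat) \<Rightarrow> 'a set set \<Rightarrow> 'a set list \<Rightarrow> bool" where
  "saturating_sequence q d N r G es \<longleftrightarrow>
     distinct es \<and> set es = complete_partite q d N - G \<and>
     (\<forall>j<length es. \<exists>H. directed_copy q d N r H \<and>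
        H \<subseteq> G \<union> set (take (Suc j) es) \<and> es ! j \<in> H)"

definition weakly_saturated ::
    "nat \<Rightarrow> nat \<Rightarrow> (nat \<Rightarrow> 'a set) \<Rightarrow> (nat \<Rightarrow> nat) \<Rightarrow> 'a set set \<Rightarrow> bool" where
  "weakly_saturated q d N r G \<longleftrightarrow>
     G \<subseteq> complete_partite q d N \<and> (\<exists>es. saturating_sequence q d N r G es)"

definition weak_saturation_number ::
    "nat \<Rightarrow> nat \<Rightarrow> (nat \<Rightarrow> 'a set) \<Rightarrow> (nat \<Rightarrow> nat) \<Rightarrow> nat" where
  "weak_saturation_number q d N r = Min (card ` {G. weakly_saturated q d N r G})"

text \<open>For finite parts the minimum is taken over a finite nonempty set, hence attained.\<close>

lemma weakly_saturated_complete_partite: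
  "weakly_saturated q d N r (complete_partite q d N)"
  unfolding weakly_saturated_def saturating_sequence_def
  by (intro conjI exI[of _ "[]"]) auto

lemma finite_weakly_saturated:
  assumes "\<And>i. i \<in> {1..d} \<Longrightarrow> finite (N i)"
  shows "finite {G. weakly_saturated q d N r G}"
proof -
  have "finite (vertices d N)"
    using assms by (simp add: vertices_def)
  moreover have "complete_partite q d N \<subseteq> Pow (vertices d N)"
    by (auto simp: complete_partite_def)
  ultimately have "finite (complete_partite q d N)"
    by (meson finite_Pow_iff finite_subset)
  then have "finite (Pow (complete_partite q d N))"
    by simp
  then show ?thesis
    by (rule rev_finite_subset) (auto simp: weakly_saturated_def)
qed

lemma weak_saturation_number_attained:
  assumes "\<And>i. i \<in> {1..d} \<Longrightarrow> finite (N i)"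
  shows "\<exists>G. weakly_saturated q d N r G \<and> card G = weak_saturation_number q d N r"
proof -
  have "finite {G. weakly_saturated q d N r G}"
    using assms by (rule finite_weakly_saturated)
  moreover have "{G. weakly_saturated q d N r G} \<noteq> {}"
    using weakly_saturated_complete_partite by blast
  ultimately have "weak_saturation_number q d N r \<in> card ` {G. weakly_saturated q d N r G}"
    unfolding weak_saturation_number_def by (intro Min_in) simp_all
  then show ?thesis by auto
qed

end

theory Submission
  imports Defs "HOL-Computational_Algebra.Polynomial"
begin

text \<open>Both bounds rest on the same index set: the functions \<open>f\<close> on \<open>{1..d}\<close> that take
  \<open>n i - r i + 1\<close> possible values at \<open>i\<close>, one of them a base value, and leave the base value at
  \<open>q\<close> places or fewer. Sorting these functions by the set \<open>I\<close> of places where they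
  leave it shows that their number is \<open>D = (\<Sum>I. \<Prod>i\<in>I. n i - r i)\<close>, the second sum of the
  formula (\<open>card_few_deviations\<close>). The first sum counts all edges, so the claim is that at most
  \<open>D\<close> edges can be missing from a weakly saturated graph, and that \<open>D\<close> can be.

  For the lower bound on the saturation number, label the vertices by distinct nonzero scalars
  and evaluate a polynomial in \<open>x 1, \<dots>, x d\<close> at an edge \<open>e\<close> by letting \<open>x i\<close> be the label
  of the vertex of \<open>e\<close> in part \<open>i\<close>, or \<open>0\<close> if \<open>e\<close> misses that part. For a copy induced by
  \<open>R\<close>, the product over all \<open>i\<close> and all \<open>v \<in> N i - R\<close> of \<open>x i\<close> minus the label of \<open>v\<close> is
  nonzero exactly at the edges of the copy: a factor vanishes only if \<open>e\<close> contains a vertex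
  outside \<open>R\<close>, as labels are nonzero. Its degree in \<open>x i\<close> is \<open>n i - r i\<close>. Since an edge has
  \<open>q\<close> vertices, a monomial in more than \<open>q\<close> variables vanishes at every edge, so all these
  functions lie in the span of only \<open>D\<close> monomials (\<open>copy_support_in_span\<close>). The copies that
  create the missing edges one by one give functions that form a triangular system on the missing
  edges; they are linearly independent there, so at most \<open>D\<close> edges are missing
  (\<open>card_missing_edges_le\<close>).

  For the upper bound, set aside a core of \<open>r i - 1\<close> vertices in each part and choose a base
  vertex among the remaining \<open>n i - r i + 1\<close>. A transversal \<open>f\<close> of the remaining vertices with at
  most \<open>q\<close> nonbase vertices gives an edge: its nonbase vertices, filled up to \<open>q\<close> vertices by base
  vertices in places that depend only on the set of nonbase places. Leave out these \<open>D\<close> edges.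
  The cores together with \<open>f\<close> induce a copy; apart from the edge of \<open>f\<close>, its missing edges
  have fewer nonbase vertices. So the missing edges can be added in order of their number of
  nonbase vertices (\<open>weakly_saturated_construction\<close>).\<close>

section \<open>Partial transversals and edges\<close>

text \<open>With \<open>z = 0\<close> this counts monomials in few variables; with \<open>z\<close> the base vertices it counts
  the edges left out by the construction.\<close>

lemma card_few_deviations:
  assumes D: "finite D" and T: "\<And>i. i \<in> D \<Longrightarrow> finite (T i)" and z: "\<And>i. i \<in> D \<Longrightarrow> z i \<in> T i"
  shows "finite {f \<in> PiE D T. card {i\<in>D. f i \<noteq> z i} \<le> q}"
    and "card {f \<in> PiE D T. card {i\<in>D. f i \<noteq> z i} \<le> q}
           = (\<Sum>I | I \<subseteq> D \<and> card I \<le> q. \<Prod>i\<in>I. card (T i) - 1)"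
proof -
  let ?A = "{f \<in> PiE D T. card {i\<in>D. f i \<noteq> z i} \<le> q}"
  let ?J = "{I. I \<subseteq> D \<and> card I \<le> q}"
  let ?P = "\<lambda>I. PiE D (\<lambda>i. if i \<in> I then T i - {z i} else {z i})"
  have finP: "finite (PiE D T)"
    using D T by (intro finite_PiE) auto
  then show "finite ?A" by simp
  have finJ: "finite ?J"
    using D by simp
  have supp: "{i\<in>D. f i \<noteq> z i} = I" if "I \<subseteq> D" "f \<in> ?P I" for f I
    using that by (force simp: PiE_iff split: if_splits)
  have sub: "?P I \<subseteq> PiE D T" for I
    using z by (intro PiE_mono) auto
  have "?A = (\<Union>I\<in>?J. ?P I)"
  proof (intro subset_antisym subsetI)
    fix f assume "f \<in> ?A"
    then show "f \<in> (\<Union>I\<in>?J. ?P I)"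
      by (intro UN_I[of "{i\<in>D. f i \<noteq> z i}"]) (auto simp: PiE_iff)
  next
    fix f assume "f \<in> (\<Union>I\<in>?J. ?P I)"
    then obtain I where I: "I \<subseteq> D" "card I \<le> q" "f \<in> ?P I" by blast
    then show "f \<in> ?A"
      using supp[OF I(1,3)] sub[of I] by auto
  qed
  also have "card \<dots> = (\<Sum>I\<in>?J. card (?P I))"
  proof (rule card_UN_disjoint[OF finJ])
    show "\<forall>I\<in>?J. finite (?P I)"
      using finite_subset[OF sub finP] by simp
    show "\<forall>I\<in>?J. \<forall>K\<in>?J. I \<noteq> K \<longrightarrow> ?P I \<inter> ?P K = {}"
    proof (intro ballI impI)
      fix I K assume IK: "I \<in> ?J" "K \<in> ?J" "I \<noteq> K"
      have "f \<notin> ?P K" if "f \<in> ?P I" for f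
        using supp[of I f] supp[of K f] IK that by auto
      then show "?P I \<inter> ?P K = {}" by auto
    qed
  qed
  also have "\<dots> = (\<Sum>I\<in>?J. \<Prod>i\<in>I. card (T i) - 1)"
  proof (rule sum.cong[OF refl])
    fix I assume "I \<in> ?J"
    then have I: "I \<subseteq> D" by simp
    have "card (?P I) = (\<Prod>i\<in>D. if i \<in> I then card (T i) - 1 else 1)"
      unfolding card_PiE[OF D] using z T by (intro prod.cong) auto
    also have "\<dots> = (\<Prod>i\<in>I. card (T i) - 1)"
      using prod.inter_restrict[OF D, of "\<lambda>i. card (T i) - 1" I] I
      by (simp add: Int_absorb1)
    finally show "card (?P I) = (\<Prod>i\<in>I. card (T i) - 1)" .
  qed
  finally show "card ?A = (\<Sum>I\<in>?J. \<Prod>i\<in>I. card (T i) - 1)" .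
qed

text \<open>Edges are images of partial transversals. As the parts are disjoint, the image determines the
  transversal: its value at \<open>i\<close> is the only vertex of the image in part \<open>i\<close>.\<close>

lemma image_Int_part:
  assumes "disjoint_family_on N D" "I \<subseteq> D" "f \<in> Pi I N" "i \<in> D"
  shows "f ` I \<inter> N i = (if i \<in> I then {f i} else {})"
proof -
  have "k = i" if "k \<in> I" "f k \<in> N i" for k
    using assms that unfolding disjoint_family_on_def by blast
  then show ?thesis
    using assms(3) by auto
qed

lemma transversal_unique:
  assumes N: "disjoint_family_on N D" and I: "I \<subseteq> D" "f \<in> Pi I N"
    and sub: "f ` I \<subseteq> g ` J" and J: "J \<subseteq> D" "g \<in> Pi J N"
  shows "I \<subseteq> J" and "i \<in> I \<Longrightarrow> f i = g i"
proof -
  have *: "i \<in> J \<and> f i = g i" if "i \<in> I" for i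
  proof -
    have "f i \<in> g ` J \<inter> N i" using that I sub by auto
    also have "g ` J \<inter> N i = (if i \<in> J then {g i} else {})"
      using that I(1) by (intro image_Int_part[OF N J]) auto
    finally show ?thesis by (auto split: if_splits)
  qed
  then show "I \<subseteq> J" and "i \<in> I \<Longrightarrow> f i = g i" by auto
qed

lemma inj_on_transversal:
  assumes "disjoint_family_on N D" "I \<subseteq> D" "f \<in> Pi I N"
  shows "inj_on f I"
proof (rule inj_onI)
  fix i k assume i: "i \<in> I" and k: "k \<in> I" and eq: "f i = f k"
  have "f i \<in> N i" "f i \<in> N k"
    using Pi_mem[OF assms(3) i] Pi_mem[OF assms(3) k] eq by simp_all
  then show "i = k"
    using assms(1,2) i k unfolding disjoint_family_on_def by blast
qed

lemma complete_partite_iff_transversal: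
  assumes N: "disjoint_family_on N {1..d}"
  shows "e \<in> complete_partite q d N \<longleftrightarrow>
    (\<exists>I f. I \<subseteq> {1..d} \<and> card I = q \<and> f \<in> PiE I N \<and> e = f ` I)"
proof
  assume e: "e \<in> complete_partite q d N"
  define I where "I = {i\<in>{1..d}. e \<inter> N i \<noteq> {}}"
  define f where "f = (\<lambda>i\<in>I. SOME x. x \<in> e \<inter> N i)"
  have fi: "f i \<in> e \<inter> N i" if "i \<in> I" for i
    using that some_in_eq[of "e \<inter> N i"] by (simp add: f_def I_def)
  have "finite e" using e by (simp add: complete_partite_def)
  have "x \<in> f ` I" if x: "x \<in> e" for x
  proof -
    obtain i where i: "i \<in> {1..d}" "x \<in> N i"
      using e x by (auto simp: complete_partite_def vertices_def)
    then have "i \<in> I" using x by (auto simp: I_def)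
    moreover have "x = f i"
      using fi[OF \<open>i \<in> I\<close>] e i x \<open>finite e\<close>
      by (simp add: complete_partite_def card_le_Suc0_iff_eq)
    ultimately show ?thesis by blast
  qed
  then have "e = f ` I" using fi by blast
  moreover have I: "I \<subseteq> {1..d}" by (auto simp: I_def)
  moreover have f: "f \<in> PiE I N" using fi by (auto simp: f_def)
  moreover have "card I = q"
    using inj_on_transversal[OF N I, of f] f \<open>e = f ` I\<close> e
    by (simp add: PiE_def card_image complete_partite_def)
  ultimately show "\<exists>I f. I \<subseteq> {1..d} \<and> card I = q \<and> f \<in> PiE I N \<and> e = f ` I" by blast
next
  assume "\<exists>I f. I \<subseteq> {1..d} \<and> card I = q \<and> f \<in> PiE I N \<and> e = f ` I"
  then obtain I f where I: "I \<subseteq> {1..d}" "card I = q" "f \<in> Pi I N" "e = f ` I"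
    by (auto simp: PiE_def)
  then have "finite I" using finite_subset by blast
  moreover have "card e = q"
    using inj_on_transversal[OF N I(1,3)] I by (simp add: card_image)
  moreover have "card (e \<inter> N i) \<le> 1" if "i \<in> {1..d}" for i
    unfolding I(4) image_Int_part[OF N I(1,3) that] by simp
  ultimately show "e \<in> complete_partite q d N"
    using I by (auto simp: complete_partite_def vertices_def)
qed

lemma complete_partite_Int_part:
  assumes "disjoint_family_on N {1..d}" "e \<in> complete_partite q d N"
  shows "card {i\<in>{1..d}. e \<inter> N i \<noteq> {}} = q"
proof -
  obtain I f where I: "I \<subseteq> {1..d}" "card I = q" "f \<in> Pi I N" "e = f ` I"
    using assms by (auto simp: complete_partite_iff_transversal PiE_def)
  have "i \<in> {1..d} \<and> e \<inter> N i \<noteq> {} \<longleftrightarrow> i \<in> I" for i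
  proof (cases "i \<in> {1..d}")
    case True
    then show ?thesis
      unfolding I(4) image_Int_part[OF assms(1) I(1,3) True] by simp
  next
    case False
    then show ?thesis using I(1) by blast
  qed
  then have "{i\<in>{1..d}. e \<inter> N i \<noteq> {}} = I" by blast
  then show ?thesis using I by simp
qed

lemma card_complete_partite:
  assumes N: "disjoint_family_on N {1..d}" and fin: "\<And>i. i \<in> {1..d} \<Longrightarrow> finite (N i)"
  shows "finite (complete_partite q d N)"
    and "card (complete_partite q d N) = (\<Sum>I | I \<subseteq> {1..d} \<and> card I = q. \<Prod>i\<in>I. card (N i))"
proof -
  let ?J = "{I. I \<subseteq> {1..d} \<and> card I = q}"
  let ?S = "Sigma ?J (\<lambda>I. PiE I N)"
  have fI: "finite I" if "I \<in> ?J" for I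
    using that finite_subset by blast
  have finP: "finite (PiE I N)" if "I \<in> ?J" for I
    using that fI[OF that] fin by (intro finite_PiE) auto
  have eq: "complete_partite q d N = (\<lambda>(I, f). f ` I) ` ?S"
  proof (rule set_eqI)
    show "e \<in> complete_partite q d N \<longleftrightarrow> e \<in> (\<lambda>(I, f). f ` I) ` ?S" for e
      unfolding complete_partite_iff_transversal[OF N] by auto
  qed
  show "finite (complete_partite q d N)"
    unfolding eq using finP by (intro finite_imageI finite_SigmaI) auto
  have "inj_on (\<lambda>(I, f). f ` I) ?S"
  proof (rule inj_onI, clarify)
    fix I f J g
    assume I: "I \<subseteq> {1..d}" "f \<in> PiE I N" and J: "J \<subseteq> {1..d}" "g \<in> PiE J N"
      and eq: "f ` I = g ` J"
    have fg: "f \<in> Pi I N" "g \<in> Pi J N" using I J by auto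
    have "I = J"
      using transversal_unique(1)[OF N I(1) fg(1) _ J(1) fg(2)]
        transversal_unique(1)[OF N J(1) fg(2) _ I(1) fg(1)] eq by blast
    moreover have "f = g"
    proof (rule PiE_ext)
      show "f \<in> PiE I N" "g \<in> PiE I N" using I J \<open>I = J\<close> by auto
      show "f i = g i" if "i \<in> I" for i
        using transversal_unique(2)[OF N I(1) fg(1) _ J(1) fg(2) that] eq by blast
    qed
    ultimately show "I = J \<and> f = g" by simp
  qed
  then have "card (complete_partite q d N) = card ?S"
    unfolding eq by (rule card_image)
  also have "\<dots> = (\<Sum>I\<in>?J. card (PiE I N))"
    using finP by (intro card_SigmaI) auto
  also have "\<dots> = (\<Sum>I\<in>?J. \<Prod>i\<in>I. card (N i))"
    by (intro sum.cong refl card_PiE fI)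
  finally show "card (complete_partite q d N) = (\<Sum>I\<in>?J. \<Prod>i\<in>I. card (N i))" .
qed

section \<open>Linear independence bounds the number of missing edges\<close>

text \<open>The induction is Gaussian elimination: the equation of \<open>a\<close> serves to eliminate an unknown
  \<open>p\<close> from the other equations, which leaves one equation and one unknown less.\<close>

lemma nontrivial_kernel:
  fixes w :: "'b \<Rightarrow> 'e \<Rightarrow> 'f :: field"
  assumes "finite A" "finite E" "card A < card E"
  shows "\<exists>y. (\<exists>e\<in>E. y e \<noteq> 0) \<and> (\<forall>a\<in>A. (\<Sum>e\<in>E. y e * w a e) = 0)"
  using assms
proof (induction A arbitrary: E w rule: finite_induct)
  case empty
  then have "E \<noteq> {}" by auto
  then show ?case by (intro exI[of _ "\<lambda>_. 1"]) auto
next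
  case (insert a A)
  show ?case
  proof (cases "\<forall>e\<in>E. w a e = 0")
    case True
    moreover have "card A < card E" using insert.prems insert.hyps by simp
    ultimately show ?thesis
      using insert.IH[OF insert.prems(1), of w] by auto
  next
    case False
    then obtain p where p: "p \<in> E" "w a p \<noteq> 0" by blast
    let ?E = "E - {p}"
    let ?w = "\<lambda>b e. w b e - w b p / w a p * w a e"
    have "card A < card ?E" using insert.prems insert.hyps p by simp
    then obtain y where y: "\<exists>e\<in>?E. y e \<noteq> 0" "\<forall>b\<in>A. (\<Sum>e\<in>?E. y e * ?w b e) = 0"
      using insert.IH[of ?E ?w] insert.prems by auto
    define s where "s = (\<Sum>e\<in>?E. y e * w a e)"
    \<comment> \<open>The value at \<open>p\<close> is forced by the equation of \<open>a\<close>.\<close>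
    define y' where "y' = y(p := - s / w a p)"
    have split: "(\<Sum>e\<in>E. y' e * w b e) = - s / w a p * w b p + (\<Sum>e\<in>?E. y e * w b e)" for b
      using insert.prems p by (simp add: sum.remove[of E p] y'_def)
    have "(\<Sum>e\<in>E. y' e * w b e) = 0" if "b \<in> insert a A" for b
    proof (cases "b = a")
      case True
      then show ?thesis using p by (simp add: split s_def)
    next
      case False
      then have "(\<Sum>e\<in>?E. y e * ?w b e) = 0" using y that by blast
      moreover have "(\<Sum>e\<in>?E. y e * ?w b e) = (\<Sum>e\<in>?E. y e * w b e) - w b p / w a p * s"
        by (simp add: s_def right_diff_distrib sum_subtractf sum_distrib_left algebra_simps)
      ultimately show ?thesis by (simp add: split)
    qed
    moreover have "\<exists>e\<in>E. y' e \<noteq> 0" using y by (auto simp: y'_def)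
    ultimately show ?thesis by blast
  qed
qed

text \<open>The functions given for the positions \<open>j\<close> are linearly independent on \<open>es\<close>, being nonzero at
  position \<open>j\<close> and zero after it, while they lie in the span of \<open>card A\<close> functions.
  Stated dually: a vector \<open>y\<close> orthogonal to the span must vanish, position by position.\<close>

lemma triangular_family_bound:
  fixes w :: "'b \<Rightarrow> 'e \<Rightarrow> 'f :: field"
  assumes A: "finite A" and es: "distinct es"
    and g: "\<And>j. j < length es \<Longrightarrow> \<exists>c. (\<Sum>a\<in>A. c a * w a (es ! j)) \<noteq> 0 \<and>
              (\<forall>k. j < k \<and> k < length es \<longrightarrow> (\<Sum>a\<in>A. c a * w a (es ! k)) = 0)"
  shows "length es \<le> card A"
proof (rule ccontr)
  assume "\<not> length es \<le> card A"
  then have "card A < card (set es)" using es by (simp add: distinct_card)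
  then obtain y where y: "\<exists>e\<in>set es. y e \<noteq> 0"
      and ker: "\<And>a. a \<in> A \<Longrightarrow> (\<Sum>e\<in>set es. y e * w a e) = 0"
    using nontrivial_kernel[OF A finite_set[of es], of w] by blast
  have "y (es ! j) = 0" if "j < length es" for j
    using that
  proof (induction j rule: less_induct)
    case (less j)
    obtain c where c: "(\<Sum>a\<in>A. c a * w a (es ! j)) \<noteq> 0"
      and later: "\<And>k. j < k \<Longrightarrow> k < length es \<Longrightarrow> (\<Sum>a\<in>A. c a * w a (es ! k)) = 0"
      using g[OF less.prems] by blast
    have "0 = (\<Sum>a\<in>A. c a * (\<Sum>e\<in>set es. y e * w a e))"
      by (simp add: ker)
    also have "\<dots> = (\<Sum>e\<in>set es. y e * (\<Sum>a\<in>A. c a * w a e))"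
      by (simp add: sum_distrib_left sum.swap[of _ A] mult.left_commute)
    also have "\<dots> = (\<Sum>k<length es. y (es ! k) * (\<Sum>a\<in>A. c a * w a (es ! k)))"
      by (rule sum.reindex_bij_betw[OF bij_betw_nth[OF es refl refl], symmetric])
    also have "\<dots> = (\<Sum>k\<in>{j}. y (es ! k) * (\<Sum>a\<in>A. c a * w a (es ! k)))"
    proof (rule sum.mono_neutral_right)
      show "\<forall>k\<in>{..<length es} - {j}. y (es ! k) * (\<Sum>a\<in>A. c a * w a (es ! k)) = 0"
      proof
        fix k assume k: "k \<in> {..<length es} - {j}"
        then show "y (es ! k) * (\<Sum>a\<in>A. c a * w a (es ! k)) = 0"
          using less.IH[of k] later[of k] by (cases "k < j") auto
      qed
    qed (use less.prems in auto)
    finally show ?case using c by simp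
  qed
  then show False using y by (metis in_set_conv_nth)
qed

text \<open>The term \<open>sum \<alpha> (e \<inter> N i)\<close> is the value of the variable \<open>x i\<close> at \<open>e\<close>: the label of the only
  vertex of \<open>e\<close> in part \<open>i\<close>, or \<open>0\<close>. The witness \<open>c\<close> consists of the coefficients of
  the product, over all parts, of the polynomial \<open>p i\<close> with roots at the labels of
  \<open>N i - R\<close>. Keeping only the monomials in at most \<open>q\<close> variables does not change its values at edges.\<close>

lemma copy_support_in_span:
  fixes N :: "nat \<Rightarrow> 'a set"
  assumes N: "disjoint_family_on N {1..d}"
    and fin: "\<And>i. i \<in> {1..d} \<Longrightarrow> finite (N i)"
    and \<alpha>: "inj_on \<alpha> (vertices d N)" "\<And>v. v \<in> vertices d N \<Longrightarrow> \<alpha> v \<noteq> (0 :: 'f :: field)"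
    and H: "directed_copy q d N r H"
  shows "\<exists>c. \<forall>e \<in> complete_partite q d N.
    (\<Sum>a | a \<in> PiE {1..d} (\<lambda>i. {..card (N i) - r i}) \<and> card {i\<in>{1..d}. a i \<noteq> 0} \<le> q.
       c a * (\<Prod>i\<in>{1..d}. sum \<alpha> (e \<inter> N i) ^ a i)) \<noteq> 0 \<longleftrightarrow> e \<in> H"
proof -
  let ?E = "complete_partite q d N"
  let ?F = "PiE {1..d} (\<lambda>i. {..card (N i) - r i})"
  let ?A = "{a \<in> ?F. card {i\<in>{1..d}. a i \<noteq> 0} \<le> q}"
  obtain R where R: "\<And>i. i \<in> {1..d} \<Longrightarrow> card (R \<inter> N i) = r i" "H = induced_subgraph ?E R"
    using H unfolding directed_copy_def by blast
  define p where "p i = (\<Prod>v\<in>N i - R. [:- \<alpha> v, 1:])" for i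
  define c where "c a = (\<Prod>i\<in>{1..d}. coeff (p i) (a i))" for a
  have deg: "degree (p i) \<le> card (N i) - r i" if "i \<in> {1..d}" for i
  proof -
    have "degree (p i) \<le> (\<Sum>v\<in>N i - R. degree [:- \<alpha> v, 1:])"
      unfolding p_def using degree_prod_sum_le[of "N i - R" "\<lambda>v. [:- \<alpha> v, 1:]"] fin[OF that]
      by (simp add: o_def)
    also have "\<dots> = card (N i) - card (R \<inter> N i)"
      using fin[OF that] by (simp add: card_Diff_subset_Int Int_commute)
    finally show ?thesis using R(1)[OF that] by simp
  qed
  have "(\<Sum>a\<in>?A. c a * (\<Prod>i\<in>{1..d}. sum \<alpha> (e \<inter> N i) ^ a i)) \<noteq> 0 \<longleftrightarrow> e \<in> H" if e: "e \<in> ?E" for e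
  proof -
    define t where "t i = sum \<alpha> (e \<inter> N i)" for i
    have zero: "\<alpha> x \<noteq> 0" if "x \<in> N i" "i \<in> {1..d}" for x i
      using \<alpha>(2)[of x] that unfolding vertices_def by blast
    have root: "poly (p i) (t i) = 0 \<longleftrightarrow> \<not> e \<inter> N i \<subseteq> R" if i: "i \<in> {1..d}" for i
    proof -
      have "card (e \<inter> N i) \<le> 1" "finite (e \<inter> N i)"
        using e i by (auto simp: complete_partite_def)
      then consider "e \<inter> N i = {}" | x where "e \<inter> N i = {x}"
        by (metis card_0_eq card_1_singletonE le_Suc_eq le_zero_eq One_nat_def)
      then show ?thesis
      proof cases
        case 1
        then show ?thesis
          using zero[OF _ i] fin[OF i] by (auto simp: p_def t_def poly_prod)
      next
        case 2
        then have "x \<in> N i" by auto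
        moreover have "\<alpha> x = \<alpha> v \<longleftrightarrow> x = v" if "v \<in> N i" for v
          using inj_on_eq_iff[OF \<alpha>(1), of x v] that \<open>x \<in> N i\<close> i unfolding vertices_def by blast
        ultimately show ?thesis
          using 2 fin[OF i] by (auto simp: p_def t_def poly_prod)
      qed
    qed
    have "(\<Sum>a\<in>?A. c a * (\<Prod>i\<in>{1..d}. t i ^ a i)) = (\<Sum>a\<in>?F. c a * (\<Prod>i\<in>{1..d}. t i ^ a i))"
    proof (rule sum.mono_neutral_left)
      show "finite ?F" by (intro finite_PiE) auto
      show "\<forall>a\<in>?F - ?A. c a * (\<Prod>i\<in>{1..d}. t i ^ a i) = 0"
      proof
        fix a assume "a \<in> ?F - ?A"
        then have "card {i\<in>{1..d}. e \<inter> N i \<noteq> {}} < card {i\<in>{1..d}. a i \<noteq> 0}"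
          using complete_partite_Int_part[OF N e] by auto
        then have "\<not> {i\<in>{1..d}. a i \<noteq> 0} \<subseteq> {i\<in>{1..d}. e \<inter> N i \<noteq> {}}"
          using card_mono[of "{i\<in>{1..d}. e \<inter> N i \<noteq> {}}" "{i\<in>{1..d}. a i \<noteq> 0}"]
          by auto
        then obtain i where "i \<in> {1..d}" "a i \<noteq> 0" "e \<inter> N i = {}" by blast
        then have "t i ^ a i = 0" by (simp add: t_def)
        with \<open>i \<in> {1..d}\<close> show "c a * (\<Prod>i\<in>{1..d}. t i ^ a i) = 0"
          by (metis finite_atLeastAtMost mult_zero_right prod_zero_iff)
      qed
    qed auto
    also have "\<dots> = (\<Sum>a\<in>?F. \<Prod>i\<in>{1..d}. coeff (p i) (a i) * t i ^ a i)"
      by (simp add: c_def prod.distrib)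
    also have "\<dots> = (\<Prod>i\<in>{1..d}. \<Sum>k\<le>card (N i) - r i. coeff (p i) k * t i ^ k)"
      by (rule prod_sum_PiE[symmetric]) auto
    also have "\<dots> = (\<Prod>i\<in>{1..d}. poly (p i) (t i))"
    proof (rule prod.cong[OF refl])
      fix i assume "i \<in> {1..d}"
      then show "(\<Sum>k\<le>card (N i) - r i. coeff (p i) k * t i ^ k) = poly (p i) (t i)"
        unfolding poly_altdef using deg[of i]
        by (intro sum.mono_neutral_right) (auto simp: coeff_eq_0)
    qed
    also have "\<dots> \<noteq> 0 \<longleftrightarrow> (\<forall>i\<in>{1..d}. e \<inter> N i \<subseteq> R)"
      unfolding prod_zero_iff[OF finite_atLeastAtMost] using root by blast
    also have "\<dots> \<longleftrightarrow> e \<subseteq> R"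
    proof -
      have "e \<subseteq> (\<Union>i\<in>{1..d}. N i)"
        using e by (simp add: complete_partite_def vertices_def)
      then show ?thesis by blast
    qed
    finally show ?thesis
      using e by (simp add: t_def R(2) induced_subgraph_def)
  qed
  then show ?thesis by blast
qed

text \<open>In a saturating sequence the copy that creates the \<open>j\<close>-th edge contains that edge but none of
  the later ones, which is the triangular shape.\<close>

lemma card_missing_edges_le:
  assumes N: "disjoint_family_on N {1..d}"
    and fin: "\<And>i. i \<in> {1..d} \<Longrightarrow> finite (N i)"
    and G: "weakly_saturated q d N r G"
  shows "card (complete_partite q d N - G)
    \<le> (\<Sum>I | I \<subseteq> {1..d} \<and> card I \<le> q. \<Prod>i\<in>I. card (N i) - r i)"
proof -
  let ?A = "{a \<in> PiE {1..d} (\<lambda>i. {..card (N i) - r i}). card {i\<in>{1..d}. a i \<noteq> 0} \<le> q}"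
  obtain es where es: "distinct es" "set es = complete_partite q d N - G"
    and step: "\<And>j. j < length es \<Longrightarrow> \<exists>H. directed_copy q d N r H \<and>
        H \<subseteq> G \<union> set (take (Suc j) es) \<and> es ! j \<in> H"
    using G unfolding weakly_saturated_def saturating_sequence_def by blast
  have "finite (vertices d N)" using fin by (simp add: vertices_def)
  then obtain h :: "'a \<Rightarrow> nat" where h: "inj_on h (vertices d N)"
    using finite_imp_inj_to_nat_seg by blast
  \<comment> \<open>The successor makes labels nonzero, as \<open>0\<close> marks a part that the edge misses.\<close>
  define \<alpha> where "\<alpha> v = (of_nat (Suc (h v)) :: rat)" for v
  have \<alpha>: "inj_on \<alpha> (vertices d N)" "\<And>v. \<alpha> v \<noteq> 0"
    using h by (auto simp: \<alpha>_def inj_on_def simp del: of_nat_Suc)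
  define w where "w a e = (\<Prod>i\<in>{1..d}. sum \<alpha> (e \<inter> N i) ^ a i)" for a :: "nat \<Rightarrow> nat" and e
  have "length es \<le> card ?A"
  proof (rule triangular_family_bound[where w = w, OF _ es(1)])
    show "finite ?A" by (rule card_few_deviations(1)) auto
  next
    fix j assume j: "j < length es"
    obtain H where H: "directed_copy q d N r H" "H \<subseteq> G \<union> set (take (Suc j) es)" "es ! j \<in> H"
      using step[OF j] by blast
    obtain c where c: "\<And>e. e \<in> complete_partite q d N \<Longrightarrow> (\<Sum>a\<in>?A. c a * w a e) \<noteq> 0 \<longleftrightarrow> e \<in> H"
      using copy_support_in_span[OF N fin \<alpha> H(1)] unfolding w_def by blast
    have edge: "es ! k \<in> complete_partite q d N - G" if "k < length es" for k
      using that es(2) nth_mem by blast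
    have "es ! k \<notin> H" if "j < k" "k < length es" for k
    proof -
      have "es ! k \<notin> set (take (Suc j) es)"
        using that es(1) by (auto simp: in_set_conv_nth nth_eq_iff_index_eq)
      then show ?thesis using H(2) edge[OF that(2)] by blast
    qed
    then show "\<exists>c. (\<Sum>a\<in>?A. c a * w a (es ! j)) \<noteq> 0 \<and>
              (\<forall>k. j < k \<and> k < length es \<longrightarrow> (\<Sum>a\<in>?A. c a * w a (es ! k)) = 0)"
      using c edge H(3) j by (intro exI[of _ c]) auto
  qed
  also have "card ?A = (\<Sum>I | I \<subseteq> {1..d} \<and> card I \<le> q. \<Prod>i\<in>I. card (N i) - r i)"
    using card_few_deviations(2)[of "{1..d}" "\<lambda>i. {..card (N i) - r i}" "\<lambda>_. 0" q] by simp
  finally show ?thesis using distinct_card[OF es(1)] es(2) by simp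
qed

section \<open>A weakly saturated graph with many missing edges\<close>

text \<open>The missing edges can be added by increasing rank, with ties broken arbitrarily: apart from
  \<open>b\<close>, the copy given for \<open>b\<close> contains only missing edges of strictly smaller rank.\<close>

lemma weakly_saturated_of_rank:
  fixes \<rho> :: "'a set \<Rightarrow> nat"
  assumes B: "finite B" "B \<subseteq> complete_partite q d N"
    and step: "\<And>b. b \<in> B \<Longrightarrow> \<exists>H. directed_copy q d N r H \<and> b \<in> H \<and>
                  (\<forall>b'\<in>H \<inter> B. b' = b \<or> \<rho> b' < \<rho> b)"
  shows "weakly_saturated q d N r (complete_partite q d N - B)"
proof -
  obtain xs where xs: "distinct xs" "set xs = B"
    using finite_distinct_list[OF B(1)] by blast
  define es where "es = sort_key \<rho> xs"
  have es: "distinct es" "set es = B" "sorted (map \<rho> es)"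
    using xs by (auto simp: es_def)
  have "\<exists>H. directed_copy q d N r H \<and>
      H \<subseteq> (complete_partite q d N - B) \<union> set (take (Suc j) es) \<and> es ! j \<in> H"
    if j: "j < length es" for j
  proof -
    have "es ! j \<in> B" using nth_mem[OF j] es(2) by simp
    from step[OF this] obtain H where H: "directed_copy q d N r H" "es ! j \<in> H"
      "\<And>b. b \<in> H \<Longrightarrow> b \<in> B \<Longrightarrow> b = es ! j \<or> \<rho> b < \<rho> (es ! j)"
      by blast
    have "b \<in> set (take (Suc j) es)" if b: "b \<in> H" "b \<in> B" for b
    proof -
      obtain k where k: "k < length es" "b = es ! k"
        using b(2) es(2) by (metis in_set_conv_nth)
      have "k \<le> j"
      proof (rule ccontr)
        assume "\<not> k \<le> j"
        then have "\<rho> (es ! j) \<le> \<rho> b" "b \<noteq> es ! j"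
          using sorted_nth_mono[OF es(3), of j k] k j es(1) by (auto simp: nth_eq_iff_index_eq)
        then show False using H(3)[OF b] by auto
      qed
      then show ?thesis using k j by (auto simp: in_set_conv_nth intro!: exI[of _ k])
    qed
    moreover have "H \<subseteq> complete_partite q d N"
      using H(1) by (auto simp: directed_copy_def induced_subgraph_def)
    ultimately show ?thesis using H by blast
  qed
  then show ?thesis
    using es B(2) unfolding weakly_saturated_def saturating_sequence_def
    by (intro conjI exI[of _ es]) auto
qed

text \<open>Here \<open>C i\<close> is the core, \<open>z i\<close> the base vertex, \<open>supp f\<close> the set of nonbase places of \<open>f\<close>,
  \<open>K\<close> fills a set of places up to size \<open>q\<close>, and \<open>\<phi> f\<close> is the missing edge of \<open>f\<close>. That \<open>K\<close>
  depends on \<open>supp f\<close> alone is what makes the order work: a missing edge inside \<open>f\<close> with the same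
  nonbase places as \<open>f\<close> is \<open>\<phi> f\<close> itself.\<close>

lemma weakly_saturated_construction:
  assumes N: "disjoint_family_on N {1..d}" and qd: "q \<le> d"
    and fin: "\<And>i. i \<in> {1..d} \<Longrightarrow> finite (N i)"
    and r: "\<And>i. i \<in> {1..d} \<Longrightarrow> 1 \<le> r i \<and> r i \<le> card (N i)"
  shows "\<exists>B \<subseteq> complete_partite q d N. weakly_saturated q d N r (complete_partite q d N - B) \<and>
    card B = (\<Sum>I | I \<subseteq> {1..d} \<and> card I \<le> q. \<Prod>i\<in>I. card (N i) - r i)"
proof -
  have "\<exists>C \<subseteq> N i. card C = r i - 1" if "i \<in> {1..d}" for i
    using obtain_subset_with_card_n[of "r i - 1" "N i"] r[OF that] by (metis diff_le_self le_trans)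
  then obtain C where C: "\<And>i. i \<in> {1..d} \<Longrightarrow> C i \<subseteq> N i \<and> card (C i) = r i - 1" by metis
  have finC: "finite (C i)" if "i \<in> {1..d}" for i
    using C fin that finite_subset by blast
  have C_part: "k = i" if "i \<in> {1..d}" "k \<in> {1..d}" "x \<in> C k" "x \<in> N i" for i k x
    using N C[OF that(2)] that unfolding disjoint_family_on_def by blast
  define T where "T i = N i - C i" for i
  have cardT: "card (T i) = card (N i) - r i + 1" "finite (T i)" if "i \<in> {1..d}" for i
    using C[OF that] fin[OF that] r[OF that] finC[OF that] by (auto simp: T_def card_Diff_subset)
  have "\<exists>z. z \<in> T i" if "i \<in> {1..d}" for i
    using cardT[OF that] by (metis add_is_0 card.empty equals0I one_neq_zero)
  then obtain z where z: "\<And>i. i \<in> {1..d} \<Longrightarrow> z i \<in> T i" by metis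
  define supp where "supp f = {i\<in>{1..d}. f i \<noteq> z i}" for f
  define A where "A = {f \<in> PiE {1..d} T. card (supp f) \<le> q}"
  have "\<exists>K. I \<subseteq> K \<and> K \<subseteq> {1..d} \<and> card K = q" if "I \<subseteq> {1..d}" "card I \<le> q" for I
    using exists_subset_between[of I q "{1..d}"] that qd by auto
  then obtain K where K: "\<And>I. I \<subseteq> {1..d} \<Longrightarrow> card I \<le> q \<Longrightarrow> I \<subseteq> K I \<and> K I \<subseteq> {1..d} \<and> card (K I) = q"
    by metis
  define \<phi> where "\<phi> f = f ` K (supp f)" for f
  have suppK: "supp f \<subseteq> K (supp f)" "K (supp f) \<subseteq> {1..d}" "card (K (supp f)) = q" if "f \<in> A" for f
  proof -
    have "supp f \<subseteq> {1..d}" "card (supp f) \<le> q"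
      using that by (auto simp: A_def supp_def)
    from K[OF this] show "supp f \<subseteq> K (supp f)" "K (supp f) \<subseteq> {1..d}" "card (K (supp f)) = q"
      by simp_all
  qed
  have fN: "f \<in> Pi I N" if "f \<in> A" "I \<subseteq> {1..d}" for f I
    using that by (auto simp: A_def T_def PiE_def Pi_def)
  have determined: "supp f \<subseteq> supp g \<and> (supp f = supp g \<longrightarrow> f = g)"
    if f: "f \<in> A" and g: "g \<in> A" and sub: "\<phi> f \<subseteq> g ` {1..d}" for f g
  proof -
    have fg: "f i = g i" if "i \<in> K (supp f)" for i
      using transversal_unique(2)[OF N suppK(2)[OF f] fN[OF f] _ subset_refl fN[OF g]]
        suppK(2)[OF f] sub that by (simp add: \<phi>_def)
    then have "supp f \<subseteq> supp g" using suppK(1)[OF f] by (auto simp: supp_def)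
    moreover have "f = g" if "supp f = supp g"
    proof (rule PiE_ext[of f "{1..d}" T g])
      fix i assume i: "i \<in> {1..d}"
      show "f i = g i"
      proof (cases "i \<in> supp f")
        case True
        then show ?thesis using fg suppK(1)[OF f] by blast
      next
        case False
        then have "f i = z i" "g i = z i" using that i by (auto simp: supp_def)
        then show ?thesis by simp
      qed
    qed (use f g in \<open>auto simp: A_def\<close>)
    ultimately show ?thesis by blast
  qed
  have inj: "inj_on \<phi> A"
  proof (rule inj_onI)
    fix f g assume f: "f \<in> A" and g: "g \<in> A" and eq: "\<phi> f = \<phi> g"
    have "\<phi> f \<subseteq> f ` {1..d}" "\<phi> g \<subseteq> g ` {1..d}"
      using suppK(2) f g by (auto simp: \<phi>_def)
    then have "supp f = supp g"
      using determined[OF f g] determined[OF g f] eq by blast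
    moreover have "\<phi> f \<subseteq> g ` {1..d}"
      using \<open>\<phi> g \<subseteq> g ` {1..d}\<close> eq by simp
    ultimately show "f = g" using determined[OF f g] by blast
  qed
  \<comment> \<open>The number of nonbase vertices of a missing edge.\<close>
  define \<rho> where "\<rho> e = card (supp (inv_into A \<phi> e))" for e
  have A: "finite A" "card A = (\<Sum>I | I \<subseteq> {1..d} \<and> card I \<le> q. \<Prod>i\<in>I. card (T i) - 1)"
    unfolding A_def supp_def
    by (rule card_few_deviations[where D = "{1..d}", OF finite_atLeastAtMost cardT(2) z]; assumption)+
  have edges: "\<phi> ` A \<subseteq> complete_partite q d N"
  proof
    fix e assume "e \<in> \<phi> ` A"
    then obtain f where f: "f \<in> A" "e = \<phi> f" by blast
    have "restrict f (K (supp f)) \<in> PiE (K (supp f)) N" "e = restrict f (K (supp f)) ` K (supp f)"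
      using f fN[OF f(1) suppK(2)[OF f(1)]] by (auto simp: \<phi>_def)
    then show "e \<in> complete_partite q d N"
      unfolding complete_partite_iff_transversal[OF N] using suppK[OF f(1)] by blast
  qed
  have "weakly_saturated q d N r (complete_partite q d N - \<phi> ` A)"
  proof (rule weakly_saturated_of_rank[where \<rho> = \<rho>, OF _ edges])
    show "finite (\<phi> ` A)" using A by simp
    fix b assume "b \<in> \<phi> ` A"
    then obtain f where f: "f \<in> A" "b = \<phi> f" by blast
    define R where "R = (\<Union>i\<in>{1..d}. C i) \<union> f ` {1..d}"
    define H where "H = induced_subgraph (complete_partite q d N) R"
    have fT: "f i \<in> T i" if "i \<in> {1..d}" for i
      using f that by (auto simp: A_def)
    have "R \<inter> N i = insert (f i) (C i)" if i: "i \<in> {1..d}" for i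
    proof -
      have "(\<Union>k\<in>{1..d}. C k) \<inter> N i = C i"
        using C_part[OF i] C[OF i] i by blast
      moreover have "f ` {1..d} \<inter> N i = {f i}"
        using image_Int_part[OF N subset_refl fN[OF f(1) subset_refl] i] i by simp
      ultimately show ?thesis unfolding R_def by blast
    qed
    then have "card (R \<inter> N i) = r i" if i: "i \<in> {1..d}" for i
      using C[OF i] finC[OF i] fT[OF i] r[OF i] i by (simp add: T_def)
    moreover have "R \<subseteq> vertices d N"
      using C fT unfolding R_def T_def vertices_def by blast
    ultimately have copy: "directed_copy q d N r H"
      unfolding directed_copy_def H_def by blast
    have "b \<in> H"
      using f edges suppK(2)[OF f(1)] by (auto simp: H_def induced_subgraph_def R_def \<phi>_def)
    moreover have "b' = b \<or> \<rho> b' < \<rho> b" if b': "b' \<in> H \<inter> \<phi> ` A" for b'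
    proof -
      obtain g where g: "g \<in> A" "b' = \<phi> g" using b' by blast
      \<comment> \<open>Missing edges avoid the cores, so inside \<open>R\<close> they only use vertices of \<open>f\<close>.\<close>
      have "\<phi> g \<subseteq> f ` {1..d}"
      proof
        fix x assume x: "x \<in> \<phi> g"
        then obtain i where i: "i \<in> {1..d}" "x = g i"
          using g suppK(2)[OF g(1)] unfolding \<phi>_def by blast
        then have "x \<in> T i" using g(1) by (auto simp: A_def)
        then have "x \<notin> C k" if "k \<in> {1..d}" for k
          using C_part[OF i(1) that, of x] by (auto simp: T_def)
        moreover have "x \<in> R" using x g b' by (auto simp: H_def induced_subgraph_def)
        ultimately show "x \<in> f ` {1..d}" by (auto simp: R_def)
      qed
      then have "g = f \<or> supp g \<subset> supp f"
        using determined[OF g(1) f(1)] by auto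
      moreover have "finite (supp f)" by (simp add: supp_def)
      ultimately have "g = f \<or> card (supp g) < card (supp f)"
        using psubset_card_mono by blast
      then show ?thesis using f g inj by (auto simp: \<rho>_def)
    qed
    ultimately show "\<exists>H. directed_copy q d N r H \<and> b \<in> H \<and>
                  (\<forall>b'\<in>H \<inter> \<phi> ` A. b' = b \<or> \<rho> b' < \<rho> b)"
      using copy by blast
  qed
  moreover have "card (\<phi> ` A) = (\<Sum>I | I \<subseteq> {1..d} \<and> card I \<le> q. \<Prod>i\<in>I. card (N i) - r i)"
    unfolding card_image[OF inj] A(2) using cardT(1) by (intro sum.cong prod.cong refl) auto
  ultimately show ?thesis using edges by blast
qed

section \<open>The weak saturation number\<close>

text \<open>Both bounds compare the number of missing edges with the same sum, so the graph of
  \<open>weakly_saturated_construction\<close> is a smallest weakly saturated one.\<close>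

theorem theorem1p1:
  fixes d q :: nat and n r :: "nat \<Rightarrow> nat" and N :: "nat \<Rightarrow> 'a set"
  assumes "2 \<le> q" and "q \<le> d"
    and "\<And>i. i \<in> {1..d} \<Longrightarrow> 1 \<le> r i \<and> r i \<le> n i"
    and "disjoint_family_on N {1..d}"
    and "\<And>i. i \<in> {1..d} \<Longrightarrow> finite (N i) \<and> card (N i) = n i"
  shows "int (weak_saturation_number q d N r) =
    (\<Sum>I | I \<subseteq> {1..d} \<and> card I = q. \<Prod>i\<in>I. int (n i)) -
    (\<Sum>I | I \<subseteq> {1..d} \<and> card I \<le> q. \<Prod>i\<in>I. (int (n i) - int (r i)))"
proof -
  let ?E = "complete_partite q d N"
  let ?W = "{G. weakly_saturated q d N r G}"
  define D where "D = (\<Sum>I | I \<subseteq> {1..d} \<and> card I \<le> q. \<Prod>i\<in>I. card (N i) - r i)"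
  have fin: "finite (N i)" and r: "1 \<le> r i \<and> r i \<le> card (N i)" if "i \<in> {1..d}" for i
    using assms(3,5) that by auto
  have finE: "finite ?E"
    by (rule card_complete_partite(1)[OF assms(4) fin])
  obtain B where B: "B \<subseteq> ?E" "weakly_saturated q d N r (?E - B)" "card B = D"
    using weakly_saturated_construction[OF assms(4,2) fin r] unfolding D_def by blast
  have card_diff: "card (?E - M) + card M = card ?E" if "M \<subseteq> ?E" for M
    using that finE by (metis card_Diff_subset card_mono finite_subset le_add_diff_inverse2)
  have finW: "finite ?W"
    using fin by (rule finite_weakly_saturated)
  have "card (?E - B) \<le> card G" if "G \<in> ?W" for G
  proof -
    have "card (?E - G) \<le> D"
      using card_missing_edges_le[OF assms(4) fin] that unfolding D_def by simp
    moreover have "G \<subseteq> ?E" using that by (simp add: weakly_saturated_def)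
    ultimately show ?thesis using card_diff[of G] card_diff[OF B(1)] B(3) by linarith
  qed
  then have "weak_saturation_number q d N r = card (?E - B)"
    unfolding weak_saturation_number_def using finW B(2) by (intro Min_eqI) auto
  then have "int (weak_saturation_number q d N r) = int (card ?E) - int D"
    using card_diff[OF B(1)] B(3) by linarith
  also have "int (card ?E) = (\<Sum>I | I \<subseteq> {1..d} \<and> card I = q. \<Prod>i\<in>I. int (n i))"
    unfolding card_complete_partite(2)[OF assms(4) fin, simplified] of_nat_sum of_nat_prod
    by (intro sum.cong prod.cong refl) (use assms(5) in auto)
  also have "int D = (\<Sum>I | I \<subseteq> {1..d} \<and> card I \<le> q. \<Prod>i\<in>I. (int (n i) - int (r i)))"
    unfolding D_def of_nat_sum of_nat_prod
  proof (intro sum.cong prod.cong refl)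
    fix I i assume "I \<in> {I. I \<subseteq> {1..d} \<and> card I \<le> q}" "i \<in> I"
    then have "i \<in> {1..d}" by blast
    then show "int (card (N i) - r i) = int (n i) - int (r i)"
      using assms(3,5) by (metis of_nat_diff)
  qed
  finally show ?thesis .
qed

end
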